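(* Let $n$ be even and let $A$ be the hyperbolic unimodular symmetric bilinear form over $\mathbb{F}_2$ of dimension $n$, i.e. $A=P^tJP$ for some $P\in\mathrm{GL}_n(\mathbb{F}_2)$, where $J$ is the $n\times n$ matrix with $1$'s on the anti-diagonal and $0$ elsewhere. Then for every symmetric $n\times n$ matrix $B$ over $\mathbb{F}_2$, the resolvent polynomial $\det(Ax-B)$ lies in $\mathbb{F}_2[x^2]=(\mathbb{F}_2[x])^2$. Furthermore, the same holds with $\mathbb{F}_2$ replaced by any commutative ring $T$ of characteristic $2$ (with $A$ hyperbolic over $T$ and $B$ symmetric over $T$): $\det(Ax-B)\in T[x^2]$.
   Context: Over a ring of characteristic $2$, the resolvent of the pair $(A,B)$ of symmetric matrices is $\pm\det(Ax-B)$, signs being irrelevant. *)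

theory Defs
  imports "Jordan_Normal_Form.Determinant" "HOL-Library.Z2"
    "HOL-Computational_Algebra.Polynomial"
begin

text \<open>Indices of \<^typ>\<open>'a mat\<close> start at 0, so the anti-diagonal is \<open>i + j + 1 = n\<close>.\<close>

definition antidiag_mat :: "nat \<Rightarrow> 'a :: comm_ring_1 mat" where
  "antidiag_mat n = mat n n (\<lambda>(i, j). if i + j + 1 = n then 1 else 0)"

definition hyperbolic_mat :: "nat \<Rightarrow> 'a :: comm_ring_1 mat \<Rightarrow> bool" where
  "hyperbolic_mat n A \<longleftrightarrow>
     (\<exists>P \<in> carrier_mat n n. invertible_mat P \<and> A = transpose_mat P * antidiag_mat n * P)"

definition symmetric_mat :: "nat \<Rightarrow> 'a mat \<Rightarrow> bool" where
  "symmetric_mat n B \<longleftrightarrow> B \<in> carrier_mat n n \<and> transpose_mat B = B"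

definition resolvent :: "'a :: comm_ring_1 mat \<Rightarrow> 'a mat \<Rightarrow> 'a poly" where
  "resolvent A B = det ([:0, 1:] \<cdot>\<^sub>m map_mat (\<lambda>a. [:a:]) A - map_mat (\<lambda>b. [:b:]) B)"

text \<open>The subring \<open>T[x\<^sup>2]\<close> of \<open>T[x]\<close>: all \<open>q(x\<^sup>2)\<close> with \<open>q \<in> T[x]\<close>.\<close>

definition polys_in_x_squared :: "'a :: comm_ring_1 poly set" where
  "polys_in_x_squared = range (\<lambda>q. pcompose q ([:0, 1:] ^ 2))"

definition squares_of_polys :: "'a :: comm_ring_1 poly set" where
  "squares_of_polys = range (\<lambda>q. q ^ 2)"

end

theory Submission
  imports Defs
begin

text \<open>
  In characteristic 2 the terms of a permutation and of its inverse in the Leibniz expansion of the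
  determinant of a symmetric matrix \<open>M\<close> cancel, so only involutions contribute; the term of an
  involution is a product of diagonal entries and squares of entries of \<open>M\<close>. For \<open>M = x A - B\<close>
  the diagonal entries are constants because a hyperbolic form is alternating in characteristic 2
  (again by cancelling along the fixed-point-free involution \<open>k \<mapsto> n - 1 - k\<close>), and squares of
  polynomials lie in \<open>T[x\<^sup>2]\<close>.
\<close>

text \<open>Group \<open>S\<close> into orbits of \<open>t\<close>: a fixed point contributes
  \<open>g x\<close>, a two-element orbit contributes \<open>g x\<close> combined with itself.
  Working in an abstract commutative monoid lets the same argument serve for sums and for
  products.\<close>

lemma (in comm_monoid_set) involution_closed:
  assumes "finite S"
    and "\<And>x. x \<in> S \<Longrightarrow> t x \<in> S" and "\<And>x. x \<in> S \<Longrightarrow> t (t x) = x"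
    and "\<And>x. x \<in> S \<Longrightarrow> g (t x) = g x"
    and one: "\<^bold>1 \<in> R" and mult: "\<And>a b. a \<in> R \<Longrightarrow> b \<in> R \<Longrightarrow> a \<^bold>* b \<in> R"
    and "\<And>x. x \<in> S \<Longrightarrow> t x = x \<Longrightarrow> g x \<in> R"
    and "\<And>x. x \<in> S \<Longrightarrow> t x \<noteq> x \<Longrightarrow> g x \<^bold>* g x \<in> R"
  shows "F g S \<in> R"
  using assms(1-4,7,8)
proof (induction S rule: finite_psubset_induct)
  case (psubset S)
  show ?case
  proof (cases "S = {}")
    case True
    then show ?thesis using one by simp
  next
    case False
    then obtain x where x: "x \<in> S" by blast
    \<comment> \<open>Remove a whole orbit, so that \<open>t\<close> still acts on what is left; for
      a fixed point this removes just \<open>x\<close>.\<close>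
    define S' where "S' = S - {x, t x}"
    have S': "S' \<subset> S" "S' \<subseteq> S" using x by (auto simp: S'_def)
    have t: "t y \<in> S'" if "y \<in> S'" for y
    proof -
      have "y \<in> S" "y \<noteq> x" "y \<noteq> t x" using that by (auto simp: S'_def)
      then have "t y \<in> S" "t y \<noteq> t x" "t y \<noteq> x"
        using psubset.prems(1,2) x by metis+
      then show ?thesis by (simp add: S'_def)
    qed
    have IH: "F g S' \<in> R"
      using S' t psubset.prems by (intro psubset.IH) auto
    show ?thesis
    proof (cases "t x = x")
      case True
      have "F g S = g x \<^bold>* F g S'"
        using remove[OF psubset.hyps x, of g] True by (simp add: S'_def)
      then show ?thesis using mult[OF _ IH] psubset.prems(4)[OF x True] by simp
    next
      case False
      have "F g S = g x \<^bold>* F g (S - {x})" by (rule remove[OF psubset.hyps x])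
      also have "F g (S - {x}) = g (t x) \<^bold>* F g (S - {x} - {t x})"
        using False psubset.prems(1)[OF x] psubset.hyps by (intro remove) auto
      also have "S - {x} - {t x} = S'" by (auto simp: S'_def)
      finally have "F g S = (g x \<^bold>* g x) \<^bold>* F g S'"
        using psubset.prems(3)[OF x] by (simp add: assoc)
      then show ?thesis using mult[OF _ IH] psubset.prems(5)[OF x False] by simp
    qed
  qed
qed

lemma add_self_CHAR_2:
  assumes "CHAR('a :: comm_ring_1) = 2"
  shows "(a :: 'a) + a = 0"
proof -
  have "of_nat 2 = (0 :: 'a)" using of_nat_CHAR[where 'a = 'a] assms by simp
  then have "(2 :: 'a) = 0" by simp
  then show ?thesis by (metis mult_2 mult_zero_left)
qed

lemma poly_add_self_CHAR_2:
  assumes "CHAR('a :: comm_ring_1) = 2"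
  shows "(p :: 'a poly) + p = 0"
  by (rule poly_eqI) (simp only: coeff_add add_self_CHAR_2[OF assms] coeff_0)

text \<open>The cross term occurs twice and cancels. The right-hand side has the shape of the
  recursion for \<open>pcompose\<close> at \<open>x^2\<close>, which suits induction on the
  polynomial.\<close>

lemma pCons_square_CHAR_2:
  assumes "CHAR('a :: comm_ring_1) = 2"
  shows "(pCons (a :: 'a) q) ^ 2 = [:a ^ 2:] + [:0, 1:] ^ 2 * q ^ 2"
proof -
  have "pCons a q = [:a:] + [:0, 1:] * q" by simp
  then have "(pCons a q) ^ 2
      = [:a:] ^ 2 + [:0, 1:] ^ 2 * q ^ 2 + ([:a:] * ([:0, 1:] * q) + [:a:] * ([:0, 1:] * q))"
    by (simp only: power2_eq_square) (simp only: algebra_simps)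
  then show ?thesis
    by (simp only: poly_add_self_CHAR_2[OF assms]) (simp add: power2_eq_square)
qed

lemma polys_in_x_squared_const: "[:c:] \<in> polys_in_x_squared"
  unfolding polys_in_x_squared_def by (rule image_eqI[of _ _ "[:c:]"]) simp_all

lemma polys_in_x_squared_add:
  "p \<in> polys_in_x_squared \<Longrightarrow> q \<in> polys_in_x_squared \<Longrightarrow> p + q \<in> polys_in_x_squared"
  unfolding polys_in_x_squared_def by (auto simp flip: pcompose_add)

lemma polys_in_x_squared_mult:
  "p \<in> polys_in_x_squared \<Longrightarrow> q \<in> polys_in_x_squared \<Longrightarrow> p * q \<in> polys_in_x_squared"
  unfolding polys_in_x_squared_def by (auto simp flip: pcompose_mult)

lemma x_squared_in_polys_in_x_squared: "[:0, 1:] ^ 2 \<in> polys_in_x_squared"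
  unfolding polys_in_x_squared_def
  by (rule image_eqI[of _ _ "[:0, 1:]"]) (simp_all add: pcompose_pCons)

text \<open>Squaring is additive here, so it squares the coefficients and replaces \<open>x\<close>
  by \<open>x^2\<close>. The converse inclusion can fail, as an element of \<open>T\<close> need not
  be a square.\<close>

lemma square_in_polys_in_x_squared:
  assumes "CHAR('a :: comm_ring_1) = 2"
  shows "(q :: 'a poly) ^ 2 \<in> polys_in_x_squared"
proof (induction q)
  case 0
  show ?case using polys_in_x_squared_const[of "0 :: 'a"] by simp
next
  case (pCons a q)
  show ?case unfolding pCons_square_CHAR_2[OF assms, of a q]
    by (intro polys_in_x_squared_add polys_in_x_squared_mult polys_in_x_squared_const
        x_squared_in_polys_in_x_squared pCons.IH)
qed

lemma CHAR_bit: "CHAR(bit) = 2"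
proof (rule CHAR_eqI)
  show "of_nat 2 = (0 :: bit)" by simp
  show "2 dvd m" if "of_nat m = (0 :: bit)" for m
    using that by (induction m rule: nat_induct2) auto
qed

text \<open>Every element of the two-element field is its own square, so squaring a polynomial
  leaves the coefficients alone. This gives the equality of the two subrings over that
  field.\<close>

lemma pcompose_x_squared_bit: "pcompose (q :: bit poly) ([:0, 1:] ^ 2) = q ^ 2"
proof (induction q)
  case (pCons a q)
  have "a ^ 2 = a" by (cases a) simp_all
  then show ?case by (simp only: pcompose_pCons pCons_square_CHAR_2[OF CHAR_bit, of a q] pCons.IH)
qed simp

text \<open>The orbit argument is used twice, nested: additively on permutations under inversion,
  then multiplicatively on indices under a self-inverse permutation.\<close>

lemma det_symmetric_in_polys_in_x_squared:
  fixes M :: "'a :: comm_ring_1 poly mat"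
  assumes char: "CHAR('a) = 2"
    and M: "M \<in> carrier_mat n n"
    and sym: "\<And>i j. i < n \<Longrightarrow> j < n \<Longrightarrow> M $$ (i, j) = M $$ (j, i)"
    and diag: "\<And>i. i < n \<Longrightarrow> M $$ (i, i) \<in> polys_in_x_squared"
  shows "det M \<in> polys_in_x_squared"
proof -
  let ?R = "polys_in_x_squared :: 'a poly set"
  let ?f = "\<lambda>p. signof p * (\<Prod>i = 0..<n. M $$ (i, p i))"
  note add_self = poly_add_self_CHAR_2[OF char]
  have R0: "0 \<in> ?R" and R1: "1 \<in> ?R"
    using polys_in_x_squared_const[of "0 :: 'a"] polys_in_x_squared_const[of "1 :: 'a"]
    by (simp_all add: one_pCons)
  have "(- 1 :: 'a poly) = 1"
    using add_self[of 1] by (simp add: eq_neg_iff_add_eq_0 neg_eq_iff_add_eq_0)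
  then have sign: "signof p = (1 :: 'a poly)" for p :: "nat \<Rightarrow> nat" by (simp add: sign_def)
  have "(\<Sum>p | p permutes {0..<n}. ?f p) \<in> ?R"
  proof (rule sum.involution_closed[where t = Hilbert_Choice.inv])
    show "finite {p. p permutes {0..<n}}" by (simp add: finite_permutations)
  next
    fix p assume "p \<in> {p. p permutes {0..<n}}"
    then have p: "p permutes {0..<n}" by simp
    show "Hilbert_Choice.inv p \<in> {p. p permutes {0..<n}}" using permutes_inv[OF p] by simp
    show "Hilbert_Choice.inv (Hilbert_Choice.inv p) = p" by (rule permutes_inv_inv[OF p])
    \<comment> \<open>Reindexing by \<open>p\<close> turns the factors into
      \<open>M $$ (p i, i)\<close>, which symmetry transposes.\<close>
    have "(\<Prod>i = 0..<n. M $$ (i, Hilbert_Choice.inv p i)) = (\<Prod>i = 0..<n. M $$ (p i, Hilbert_Choice.inv p (p i)))"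
      by (rule prod.permute[OF p, unfolded comp_def])
    also have "\<dots> = (\<Prod>i = 0..<n. M $$ (i, p i))"
    proof (rule prod.cong[OF refl])
      fix i assume "i \<in> {0..<n}"
      then have "i < n" "p i < n" using permutes_in_image[OF p, of i] by auto
      then show "M $$ (p i, Hilbert_Choice.inv p (p i)) = M $$ (i, p i)"
        using sym permutes_inverses(2)[OF p] by simp
    qed
    finally show "?f (Hilbert_Choice.inv p) = ?f p" by (simp add: sign)
    show "?f p \<in> ?R" if "Hilbert_Choice.inv p = p"
    proof -
      have pp: "p (p i) = i" for i using permutes_inverses(2)[OF p] that by simp
      have lt: "p i < n" if "i < n" for i using permutes_in_image[OF p, of i] that by simp
      have "(\<Prod>i = 0..<n. M $$ (i, p i)) \<in> ?R"
      proof (rule prod.involution_closed[where t = p])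
        \<comment> \<open>A 2-cycle of \<open>p\<close> gives two equal factors, hence a square;
          fixed points give diagonal entries.\<close>
        show "M $$ (i, p i) * M $$ (i, p i) \<in> ?R" for i
          using square_in_polys_in_x_squared[OF char] by (simp only: power2_eq_square)
      qed (use pp lt sym diag R1 polys_in_x_squared_mult in auto)
      then show ?thesis by (simp add: sign)
    qed
    show "?f p + ?f p \<in> ?R" by (simp only: add_self R0)
  qed (use R0 polys_in_x_squared_add in auto)
  then show ?thesis using M by (simp add: det_def)
qed

lemma antidiag_mat_carrier [simp]: "antidiag_mat n \<in> carrier_mat n n"
  by (simp add: antidiag_mat_def)

lemma transpose_antidiag_mat: "transpose_mat (antidiag_mat n) = antidiag_mat n"
  by (rule eq_matI) (auto simp: antidiag_mat_def add.commute)

lemma hyperbolic_mat_carrier: "hyperbolic_mat n A \<Longrightarrow> A \<in> carrier_mat n n"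
  by (auto simp: hyperbolic_mat_def)

lemma hyperbolic_mat_symmetric:
  assumes "hyperbolic_mat n A"
  shows "transpose_mat A = A"
proof -
  obtain P where P: "P \<in> carrier_mat n n" and A: "A = transpose_mat P * antidiag_mat n * P"
    using assms by (auto simp: hyperbolic_mat_def)
  have "transpose_mat A = transpose_mat P * (transpose_mat (antidiag_mat n) * P)"
    unfolding A using P
    by (simp add: transpose_mult[of _ n n _ n])
  also have "\<dots> = A"
    unfolding A transpose_antidiag_mat using P by (simp add: assoc_mult_mat[of _ n n _ n _ n])
  finally show ?thesis .
qed

text \<open>The entry is the value of the form \<open>J\<close> at column \<open>i\<close> of
  \<open>P\<close>, a sum of products of mirrored coordinates, each occurring twice.\<close>

lemma hyperbolic_mat_diag_CHAR_2:
  fixes A :: "'a :: comm_ring_1 mat"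
  assumes char: "CHAR('a) = 2" and "even n" and "hyperbolic_mat n A" and i: "i < n"
  shows "A $$ (i, i) = 0"
proof -
  obtain P where P: "P \<in> carrier_mat n n" and A: "A = transpose_mat P * antidiag_mat n * P"
    using assms by (auto simp: hyperbolic_mat_def)
  \<comment> \<open>Left multiplication by the anti-diagonal matrix reverses the order of the
    rows.\<close>
  have JP: "(antidiag_mat n * P) $$ (k, i) = P $$ (n - 1 - k, i)" if "k < n" for k
  proof -
    have "(antidiag_mat n * P) $$ (k, i)
        = (\<Sum>l = 0..<n. (if k + l + 1 = n then 1 else 0) * P $$ (l, i))"
      using P i that by (simp add: antidiag_mat_def scalar_prod_def)
    also have "\<dots> = (\<Sum>l = 0..<n. if l = n - 1 - k then P $$ (l, i) else 0)"
      using that by (intro sum.cong) auto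
    also have "\<dots> = P $$ (n - 1 - k, i)" using that by simp
    finally show ?thesis .
  qed
  have "A = transpose_mat P * (antidiag_mat n * P)"
    unfolding A using P by (simp add: assoc_mult_mat[of _ n n _ n _ n])
  then have "A $$ (i, i) = (\<Sum>k = 0..<n. P $$ (k, i) * (antidiag_mat n * P) $$ (k, i))"
    using P i by (simp add: scalar_prod_def antidiag_mat_def)
  also have "\<dots> = (\<Sum>k = 0..<n. P $$ (k, i) * P $$ (n - 1 - k, i))"
    using JP by (intro sum.cong) auto
  \<comment> \<open>Vanishing is phrased as membership in the trivial submonoid, to fit the orbit
    argument.\<close>
  also have "\<dots> \<in> {0}"
  proof (rule sum.involution_closed[where t = "\<lambda>k. n - 1 - k"])
    fix k assume k: "k \<in> {0..<n}"
    show "P $$ (k, i) * P $$ (n - 1 - k, i) \<in> {0}" if "n - 1 - k = k"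
    proof -
      \<comment> \<open>A middle index, fixed by the reversal, exists only for odd
        \<open>n\<close>.\<close>
      have "n = 2 * k + 1" using that k by auto
      then show ?thesis using \<open>even n\<close> by simp
    qed
    show "P $$ (k, i) * P $$ (n - 1 - k, i) + P $$ (k, i) * P $$ (n - 1 - k, i) \<in> {0}"
      by (simp only: add_self_CHAR_2[OF char] singleton_iff)
  qed (auto simp: mult.commute)
  finally show ?thesis by simp
qed

lemma resolvent_in_polys_in_x_squared:
  fixes A B :: "'a :: comm_ring_1 mat"
  assumes char: "CHAR('a) = 2" and "even n" and A: "hyperbolic_mat n A" and B: "symmetric_mat n B"
  shows "resolvent A B \<in> polys_in_x_squared"
proof -
  have cA: "A \<in> carrier_mat n n" by (rule hyperbolic_mat_carrier[OF A])
  have cB: "B \<in> carrier_mat n n" and tB: "transpose_mat B = B"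
    using B by (auto simp: symmetric_mat_def)
  have sA: "A $$ (i, j) = A $$ (j, i)" if "i < n" "j < n" for i j
    using hyperbolic_mat_symmetric[OF A] cA that index_transpose_mat(1)[of i A j] by simp
  have sB: "B $$ (i, j) = B $$ (j, i)" if "i < n" "j < n" for i j
    using tB cB that index_transpose_mat(1)[of i B j] by simp
  show ?thesis unfolding resolvent_def
  proof (rule det_symmetric_in_polys_in_x_squared[OF char, where n = n])
    let ?M = "[:0, 1:] \<cdot>\<^sub>m map_mat (\<lambda>a. [:a:]) A - map_mat (\<lambda>b. [:b:]) B"
    show "?M \<in> carrier_mat n n" using cA cB by (simp add: minus_carrier_mat)
    show "?M $$ (i, j) = ?M $$ (j, i)" if "i < n" "j < n" for i j
      using cA cB that sA[OF that] sB[OF that] by simp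
    \<comment> \<open>The coefficient of \<open>x\<close> is \<open>A $$ (i, i) = 0\<close>, which
      leaves the constant \<open>- B $$ (i, i)\<close>.\<close>
    show "?M $$ (i, i) \<in> polys_in_x_squared" if "i < n" for i
      using cA cB that hyperbolic_mat_diag_CHAR_2[OF char \<open>even n\<close> A that]
        polys_in_x_squared_const[of "- (B $$ (i, i))"] by simp
  qed
qed

theorem mainTheorem9:
  fixes n :: nat
  assumes "even n"
  shows "((polys_in_x_squared :: bit poly set) = squares_of_polys \<and>
          (\<forall>A B :: bit mat. hyperbolic_mat n A \<longrightarrow> symmetric_mat n B \<longrightarrow>
             resolvent A B \<in> polys_in_x_squared)) \<and>
         (CHAR('a :: comm_ring_1) = 2 \<longrightarrow>
          (\<forall>A B :: 'a mat. hyperbolic_mat n A \<longrightarrow> symmetric_mat n B \<longrightarrow>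
             resolvent A B \<in> polys_in_x_squared))"
proof -
  have "(polys_in_x_squared :: bit poly set) = squares_of_polys"
    by (simp only: polys_in_x_squared_def squares_of_polys_def pcompose_x_squared_bit)
  then show ?thesis
    using resolvent_in_polys_in_x_squared[OF CHAR_bit assms]
      resolvent_in_polys_in_x_squared[OF _ assms] by blast
qed

end
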